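(* Let $X$ be a complex Banach space, let $A:\operatorname{dom}(A)\subseteq X\to X$ and $B:\operatorname{dom}(B)\subseteq X\to X$ be closed linear operators with $\rho(B)\neq\emptyset$, and let $Y$ be a Banach space continuously embedded in $X$ such that $\operatorname{dom}(A)\subseteq\operatorname{dom}(B^2)\cap Y$, $B(\operatorname{dom}(A))\subseteq Y\subseteq\operatorname{dom}(B)$, and the operator $G=\begin{bmatrix}-B & I \\ A+B^2 & -B\end{bmatrix}$ with domain $\operatorname{dom}(A)\times Y$ generates a $C_0$-group $\{\mathcal T(t)\}_{t\in\mathbb R}$ on $Y\times X$. Then: (i) $S_{A,B}(\cdot)x\in\mathcal C^1(\mathbb R,X)\cap\mathcal C(\mathbb R,Y)$ for every $x\in X$, and $(S_{A,B}(t)x)'=T_{22}(t)x-BS_{A,B}(t)x$ for all $t\in\mathbb R$, $x\in X$; (ii) $(S_{A,B}(t)x)'=C_{A,B}(t)x-2S_{A,B}(t)Bx$ for all $t\in\mathbb R$, $x\in\operatorname{dom}(B)$; (iii) $S_{A,B}(\cdot)y\in\mathcal C^2(\mathbb R,X)\cap\mathcal C^1(\mathbb R,Y)\cap\mathcal C(\mathbb R,\operatorname{dom}(A))$ for every $y\in Y$, and for all $t\in\mathbb R$, $y\in Y$, $$(S_{A,B}(t)y)'=C_{A,B}(t)y-2S_{A,B}(t)By,\qquad (S_{A,B}(t)y)''=AS_{A,B}(t)y-2BC_{A,B}(t)y+4BS_{A,B}(t)By;$$ (iv) $(S_{A,B}(t)x)''+2(S_{A,B}(t)Bx)'=S_{A,B}(t)Ax$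 for all $t\in\mathbb R$, $x\in\operatorname{dom}(A)$.
   Context: Domains of closed operators carry the graph norm. Write $\mathcal T(t)=\begin{bmatrix}T_{11}(t) & T_{12}(t) \\ T_{21}(t) & T_{22}(t)\end{bmatrix}$ in block form with respect to $Y\times X$. The generalized cosine and sine families $C_{A,B}(t)\in\mathcal B(\operatorname{dom}(B),X)$ and $S_{A,B}(t)\in\mathcal B(X)$ are given by $C_{A,B}(t)x=T_{22}(t)x-BT_{12}(t)x+2T_{12}(t)Bx$ for $x\in\operatorname{dom}(B)$ and $S_{A,B}(t)x=T_{12}(t)x$ for $x\in X$. Primes denote derivatives with respect to $t$ (in $X$). *)

theory Defs
  imports "HOL-Analysis.Analysis"
begin

class complex_banach = banach +
  fixes scaleC :: "complex \<Rightarrow> 'a \<Rightarrow> 'a"  (infixr "*\<^sub>C" 75)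
  assumes scaleC_add_right: "c *\<^sub>C (x + y) = c *\<^sub>C x + c *\<^sub>C y"
    and scaleC_add_left: "(c + d) *\<^sub>C x = c *\<^sub>C x + d *\<^sub>C x"
    and scaleC_scaleC: "c *\<^sub>C d *\<^sub>C x = (c * d) *\<^sub>C x"
    and scaleR_scaleC: "r *\<^sub>R x = complex_of_real r *\<^sub>C x"
    and norm_scaleC: "norm (c *\<^sub>C x) = cmod c * norm x"

instantiation prod :: (complex_banach, complex_banach) complex_banach
begin

definition scaleC_prod_def: "c *\<^sub>C p = (c *\<^sub>C fst p, c *\<^sub>C snd p)"

instance
proof
  fix c d :: complex and r :: real and x y :: "'a \<times> 'b"
  show "c *\<^sub>C (x + y) = c *\<^sub>C x + c *\<^sub>C y"
    by (simp add: scaleC_prod_def scaleC_add_right)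
  show "(c + d) *\<^sub>C x = c *\<^sub>C x + d *\<^sub>C x"
    by (simp add: scaleC_prod_def scaleC_add_left)
  show "c *\<^sub>C d *\<^sub>C x = (c * d) *\<^sub>C x"
    by (simp add: scaleC_prod_def scaleC_scaleC)
  show "r *\<^sub>R x = complex_of_real r *\<^sub>C x"
    by (simp add: scaleC_prod_def scaleR_prod_def scaleR_scaleC)
  show "norm (c *\<^sub>C x) = cmod c * norm x"
    by (simp add: scaleC_prod_def norm_prod_def norm_scaleC power_mult_distrib
        distrib_left [symmetric] real_sqrt_mult)
qed

end

definition bounded_clinear :: "('a::complex_banach \<Rightarrow> 'b::complex_banach) \<Rightarrow> bool" where
  "bounded_clinear f \<longleftrightarrow> bounded_linear f \<and> (\<forall>c x. f (c *\<^sub>C x) = c *\<^sub>C f x)"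

text \<open>An unbounded operator is a pair of a domain \<open>D\<close> and a total function \<open>A\<close>;
  only the values of \<open>A\<close> on \<open>D\<close> are meaningful.\<close>

definition closed_linear_operator ::
    "'a::complex_banach set \<Rightarrow> ('a \<Rightarrow> 'a) \<Rightarrow> bool" where
  "closed_linear_operator D A \<longleftrightarrow>
     0 \<in> D \<and>
     (\<forall>x\<in>D. \<forall>y\<in>D. x + y \<in> D \<and> A (x + y) = A x + A y) \<and>
     (\<forall>c. \<forall>x\<in>D. c *\<^sub>C x \<in> D \<and> A (c *\<^sub>C x) = c *\<^sub>C A x) \<and>
     closed {(x, A x) | x. x \<in> D}"

definition resolvent_set ::
    "'a::complex_banach set \<Rightarrow> ('a \<Rightarrow> 'a) \<Rightarrow> complex set" where
  "resolvent_set D A =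
     {z. \<exists>R. bounded_clinear R \<and>
             (\<forall>x. R x \<in> D \<and> z *\<^sub>C R x - A (R x) = x) \<and>
             (\<forall>x\<in>D. R (z *\<^sub>C x - A x) = x)}"

definition dom_square :: "'a set \<Rightarrow> ('a \<Rightarrow> 'a) \<Rightarrow> 'a set" where
  "dom_square D B = {x \<in> D. B x \<in> D}"

definition graph_norm :: "('a::real_normed_vector \<Rightarrow> 'a) \<Rightarrow> 'a \<Rightarrow> real" where
  "graph_norm A x = norm x + norm (A x)"

definition C0_group :: "(real \<Rightarrow> 'a::complex_banach \<Rightarrow> 'a) \<Rightarrow> bool" where
  "C0_group T \<longleftrightarrow>
     (\<forall>t. bounded_clinear (T t)) \<and>
     (\<forall>x. T 0 x = x) \<and>
     (\<forall>s t x. T (s + t) x = T s (T t x)) \<and>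
     (\<forall>x. continuous_on UNIV (\<lambda>t. T t x))"

definition generates_C0_group ::
    "'a::complex_banach set \<Rightarrow> ('a \<Rightarrow> 'a) \<Rightarrow> (real \<Rightarrow> 'a \<Rightarrow> 'a) \<Rightarrow> bool" where
  "generates_C0_group D G T \<longleftrightarrow>
     C0_group T \<and>
     D = {x. \<exists>y. ((\<lambda>h. (1 / h) *\<^sub>R (T h x - x)) \<longlongrightarrow> y) (at 0)} \<and>
     (\<forall>x\<in>D. ((\<lambda>h. (1 / h) *\<^sub>R (T h x - x)) \<longlongrightarrow> G x) (at 0))"

text \<open>A Banach space \<open>Y\<close> continuously embedded in \<open>X\<close> is a type \<open>'y\<close> together with
  its inclusion map \<open>\<iota> : 'y \<Rightarrow> 'x\<close>; as a subset of \<open>X\<close> it is \<open>range \<iota>\<close>.\<close>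

definition continuous_embedding :: "('y::complex_banach \<Rightarrow> 'x::complex_banach) \<Rightarrow> bool" where
  "continuous_embedding \<iota> \<longleftrightarrow> bounded_clinear \<iota> \<and> inj \<iota>"

definition G_dom :: "('y::complex_banach \<Rightarrow> 'x::complex_banach) \<Rightarrow> 'x set \<Rightarrow> ('y \<times> 'x) set" where
  "G_dom \<iota> domA = {u. \<iota> u \<in> domA} \<times> range \<iota>"

text \<open>The first component \<open>- B u + v\<close> has to be read as an element of \<open>Y\<close>; this is
  meaningful on \<open>G_dom\<close> when \<open>B\<close> maps \<open>domA\<close> into \<open>Y\<close>.\<close>

definition G_op :: "('y::complex_banach \<Rightarrow> 'x::complex_banach) \<Rightarrow> ('x \<Rightarrow> 'x) \<Rightarrow> ('x \<Rightarrow> 'x)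
    \<Rightarrow> 'y \<times> 'x \<Rightarrow> 'y \<times> 'x" where
  "G_op \<iota> A B = (\<lambda>(u, v). (inv \<iota> (- B (\<iota> u) + v), A (\<iota> u) + B (B (\<iota> u)) - B v))"

definition T12 :: "(real \<Rightarrow> 'y::complex_banach \<times> 'x::complex_banach \<Rightarrow> 'y \<times> 'x)
    \<Rightarrow> real \<Rightarrow> 'x \<Rightarrow> 'y" where
  "T12 T t x = fst (T t (0, x))"

definition T22 :: "(real \<Rightarrow> 'y::complex_banach \<times> 'x::complex_banach \<Rightarrow> 'y \<times> 'x)
    \<Rightarrow> real \<Rightarrow> 'x \<Rightarrow> 'x" where
  "T22 T t x = snd (T t (0, x))"

definition gen_sine :: "('y::complex_banach \<Rightarrow> 'x::complex_banach)
    \<Rightarrow> (real \<Rightarrow> 'y \<times> 'x \<Rightarrow> 'y \<times> 'x) \<Rightarrow> real \<Rightarrow> 'x \<Rightarrow> 'x" where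
  "gen_sine \<iota> T t x = \<iota> (T12 T t x)"

definition gen_cosine :: "('y::complex_banach \<Rightarrow> 'x::complex_banach) \<Rightarrow> ('x \<Rightarrow> 'x)
    \<Rightarrow> (real \<Rightarrow> 'y \<times> 'x \<Rightarrow> 'y \<times> 'x) \<Rightarrow> real \<Rightarrow> 'x \<Rightarrow> 'x" where
  "gen_cosine \<iota> B T t x =
     T22 T t x - B (\<iota> (T12 T t x)) + 2 *\<^sub>R \<iota> (T12 T t (B x))"

primrec Ck :: "nat \<Rightarrow> (real \<Rightarrow> 'a::real_normed_vector) \<Rightarrow> bool" where
  "Ck 0 f \<longleftrightarrow> continuous_on UNIV f"
| "Ck (Suc k) f \<longleftrightarrow> (\<exists>f'. (\<forall>t. (f has_vector_derivative f' t) (at t)) \<and> Ck k f')"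

text \<open>\<open>C\<^sup>k(\<real>, Y)\<close> for \<open>X\<close>-valued functions: the values lie in \<open>Y\<close> and differentiability is
  with respect to the norm of \<open>Y\<close>.\<close>

definition Ck_embedded :: "('y::complex_banach \<Rightarrow> 'x::complex_banach) \<Rightarrow> nat
    \<Rightarrow> (real \<Rightarrow> 'x) \<Rightarrow> bool" where
  "Ck_embedded \<iota> k f \<longleftrightarrow> (\<exists>g. (\<forall>t. f t = \<iota> (g t)) \<and> Ck k g)"

definition continuous_into_dom ::
    "'a::complex_banach set \<Rightarrow> ('a \<Rightarrow> 'a) \<Rightarrow> (real \<Rightarrow> 'a) \<Rightarrow> bool" where
  "continuous_into_dom D A f \<longleftrightarrow>
     (\<forall>t. f t \<in> D) \<and> (\<forall>t. ((\<lambda>s. graph_norm A (f s - f t)) \<longlongrightarrow> 0) (at t))"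

definition second_derivative :: "(real \<Rightarrow> 'a::real_normed_vector) \<Rightarrow> real \<Rightarrow> 'a" where
  "second_derivative f t = vector_derivative (\<lambda>s. vector_derivative f (at s)) (at t)"

end

theory Submission
  imports Defs
begin

text \<open>By the closed graph theorem \<open>B\<close> is bounded from \<open>Y\<close> to \<open>X\<close>. For an arbitrary initial value
  the integrated orbit lies in the domain of the generator, and the first row of the resulting
  identity is an integral equation whose derivative gives (i); (ii) is a reformulation of it.
  For \<open>y \<in> Y\<close> the pair \<open>(0, y)\<close> lies in the domain and is mapped to \<open>(y, - B y)\<close>. Writing \<open>p\<close> for
  the orbit of \<open>(y, - B y)\<close>, the generator equation along the orbit of \<open>(0, y)\<close> expresses
  \<open>(S y)'\<close>, \<open>(S y)''\<close>, \<open>A (S y)\<close> and \<open>B (C y)\<close> through \<open>p\<close> and the bounded operator \<open>B\<close> on \<open>Y\<close>, which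
  yields (iii). For \<open>x \<in> dom A\<close> the vector \<open>(x, - B x)\<close> is again in the domain, and (iv) is the identity
  \<open>G (x, - B x) + 2 G (0, B x) = (0, A x)\<close> transported by the group.\<close>

section \<open>The closed graph theorem\<close>

text \<open>Baire's theorem makes some sublevel set of \<open>norm (L x)\<close> dense in a ball.
  Hence every vector is approximated up to half its norm by one whose image is bounded linearly in
  that norm, and successive approximation removes the error.\<close>

lemma closed_graph_bounded_linear:
  fixes L :: "'a::banach \<Rightarrow> 'b::banach"
  assumes "linear L"
    and closed: "\<And>X a b. X \<longlonglongrightarrow> a \<Longrightarrow> (\<lambda>n. L (X n)) \<longlonglongrightarrow> b \<Longrightarrow> L a = b"
  shows "bounded_linear L"
proof -
  interpret L: linear L by fact
  define E where "E n = closure {x. norm (L x) \<le> real n}" for n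
  have "\<exists>n. interior (E n) \<noteq> {}"
  proof (rule ccontr)
    assume "\<not> ?thesis"
    then have "euclidean interior_of \<Union> (range E) = {}"
      by (intro Baire_category_alt)
        (auto simp: completely_metrizable_space_euclidean E_def interior_of_def interior_def)
    moreover have "\<Union> (range E) = UNIV"
    proof -
      have "x \<in> E (nat \<lceil>norm (L x)\<rceil>)" for x
        unfolding E_def by (intro closure_subset [THEN subsetD]) (auto simp: real_nat_ceiling_ge)
      then show ?thesis by blast
    qed
    ultimately show False by (metis interior_of_topspace topspace_euclidean UNIV_not_empty)
  qed
  then obtain n a r where r: "r > 0" and ball: "ball a r \<subseteq> E n"
    by (auto simp: mem_interior)
  \<comment> \<open>After scaling \<open>x\<close> to length \<open>r / 2\<close>, the bound
    \<open>2 * real n\<close> divided by the factor \<open>r / (2 * norm x)\<close> becomes this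
    multiple of \<open>norm x\<close>.\<close>
  define M where "M = 4 * real n / r"
  have M: "M \<ge> 0" using r by (simp add: M_def)
  \<comment> \<open>Approximate both \<open>a + x\<close> and the centre \<open>a\<close> within the
    sublevel set; the difference of the approximants loses \<open>a\<close>, at the price of
    doubling the bound.\<close>
  have small: "\<exists>u. norm (x - u) < e \<and> norm (L u) \<le> 2 * real n"
    if x: "norm x < r" and "e > 0" for x e
  proof -
    have "a + x \<in> E n" "a \<in> E n" using ball r x by (auto simp: dist_norm)
    then obtain p q where "norm (L p) \<le> n" "dist p (a + x) < e / 2" "norm (L q) \<le> n" "dist q a < e / 2"
      using \<open>e > 0\<close> unfolding E_def closure_approachable by (metis (lifting) half_gt_zero mem_Collect_eq)
    then have "norm (x - (p - q)) < e \<and> norm (L (p - q)) \<le> 2 * real n"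
      using norm_triangle_ineq4 [of "L p" "L q"] norm_triangle_ineq4 [of "q - a" "p - (a + x)"]
      by (simp add: L.diff dist_norm algebra_simps)
    then show ?thesis by blast
  qed
  have "\<exists>u. norm (x - u) \<le> norm x / 2 \<and> norm (L u) \<le> M * norm x" for x
  proof (cases "x = 0")
    case True
    then show ?thesis by (intro exI [of _ 0]) (simp add: L.zero)
  next
    case False
    define c where "c = r / (2 * norm x)"
    have c: "c > 0" using r False by (simp add: c_def)
    have "norm (c *\<^sub>R x) < r" using r False c by (simp add: c_def)
    from small [OF this, of "c * norm x / 2"] c False
    obtain u where u: "norm (c *\<^sub>R x - u) < c * norm x / 2" "norm (L u) \<le> 2 * real n" by auto
    have "x - u /\<^sub>R c = (c *\<^sub>R x - u) /\<^sub>R c" using c by (simp add: algebra_simps)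
    then have "norm (x - u /\<^sub>R c) = norm (c *\<^sub>R x - u) / c" using c by (simp add: divide_inverse)
    also have "\<dots> \<le> norm x / 2" using u(1) c by (simp add: field_simps)
    finally have 1: "norm (x - u /\<^sub>R c) \<le> norm x / 2" .
    have "norm (L (u /\<^sub>R c)) = norm (L u) / c" using c by (simp add: L.scaleR divide_inverse)
    also have "\<dots> \<le> 2 * real n / c" using u(2) c by (simp add: divide_right_mono)
    also have "\<dots> = M * norm x" by (simp add: c_def M_def)
    finally show ?thesis using 1 by blast
  qed
  then obtain g where g1: "\<And>x. norm (x - g x) \<le> norm x / 2"
    and g2: "\<And>x. norm (L (g x)) \<le> M * norm x" by metis
  \<comment> \<open>Iterating \<open>g\<close> on the remainders writes \<open>x\<close> as a series whose image under \<open>L\<close> converges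
    absolutely; closedness identifies the limit with \<open>L x\<close>.\<close>
  have "norm (L x) \<le> norm x * (2 * M)" for x
  proof -
    define rem where "rem = rec_nat x (\<lambda>_ y. y - g y)"
    have rem_0: "rem 0 = x" and rem_Suc: "rem (Suc k) = rem k - g (rem k)" for k
      by (simp_all add: rem_def)
    have rem_le: "norm (rem k) \<le> norm x * (1 / 2) ^ k" for k
    proof (induction k)
      case (Suc k)
      then show ?case using g1 [of "rem k"] by (simp add: rem_Suc)
    qed (simp add: rem_0)
    define f where "f k = L (g (rem k))" for k
    have f_le: "norm (f k) \<le> M * norm x * (1 / 2) ^ k" for k
      using g2 [of "rem k"] mult_left_mono [OF rem_le [of k] M] unfolding f_def
      by (simp add: mult.assoc)
    have geo: "(\<lambda>k. M * norm x * (1 / 2) ^ k) sums (M * norm x * 2)"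
      using sums_mult [OF geometric_sums [of "1 / 2 :: real"], of "M * norm x"] by simp
    have sf: "summable (\<lambda>k. norm (f k))"
      using f_le by (intro summable_comparison_test' [OF sums_summable [OF geo], of 0]) auto
    have "(\<lambda>k. norm x * (1 / 2) ^ k) \<longlonglongrightarrow> norm x * 0"
      by (intro tendsto_mult_left LIMSEQ_power_zero) simp
    then have "rem \<longlonglongrightarrow> 0"
      using rem_le by (intro Lim_null_comparison [of rem]) auto
    then have "(\<lambda>k. x - rem k) \<longlonglongrightarrow> x"
      using tendsto_diff [OF tendsto_const [of x] \<open>rem \<longlonglongrightarrow> 0\<close>] by simp
    moreover have "L (x - rem k) = (\<Sum>i<k. f i)" for k
    proof (induction k)
      case (Suc k)
      then show ?case by (simp add: rem_Suc f_def L.diff flip: diff_add_eq_diff_diff_swap)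
    qed (simp add: rem_0 L.zero)
    ultimately have "L x = suminf f"
      using summable_LIMSEQ [OF summable_norm_cancel [OF sf]] by (intro closed) auto
    also have "norm \<dots> \<le> (\<Sum>k. norm (f k))" by (rule summable_norm [OF sf])
    also have "\<dots> \<le> M * norm x * 2"
      using suminf_le [OF f_le sf sums_summable [OF geo]] sums_unique [OF geo] by simp
    finally show ?thesis by (simp add: algebra_simps)
  qed
  then show ?thesis using L.add L.scaleR by (intro bounded_linear_intro)
qed

section \<open>Difference quotients and antiderivatives on the real line\<close>

text \<open>Connects the limit that defines a generator with the calculus of vector derivatives, and
  lets derivatives at \<open>t\<close> be shifted to 0.\<close>

lemma has_vector_derivative_iff_quotient:
  "(f has_vector_derivative f') (at t) \<longleftrightarrow> ((\<lambda>h. (1 / h) *\<^sub>R (f (t + h) - f t)) \<longlongrightarrow> f') (at 0)"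
proof -
  have "norm (f (t + h) - f t - h *\<^sub>R f') / norm h = norm ((1 / h) *\<^sub>R (f (t + h) - f t) - f')"
    if "h \<noteq> 0" for h
  proof -
    have "(1 / h) *\<^sub>R (f (t + h) - f t) - f' = (1 / h) *\<^sub>R (f (t + h) - f t - h *\<^sub>R f')"
      using that by (simp add: scaleR_diff_right)
    then show ?thesis by simp
  qed
  then have "\<forall>\<^sub>F h in at 0. norm (f (t + h) - f t - h *\<^sub>R f') / norm h
      = norm ((1 / h) *\<^sub>R (f (t + h) - f t) - f')"
    by (auto simp: eventually_at_filter)
  from filterlim_cong [OF refl refl this]
  have "((\<lambda>h. norm (f (t + h) - f t - h *\<^sub>R f') / norm h) \<longlongrightarrow> 0) (at 0) \<longleftrightarrow>
      ((\<lambda>h. norm ((1 / h) *\<^sub>R (f (t + h) - f t) - f')) \<longlongrightarrow> 0) (at 0)" .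
  then show ?thesis
    by (simp add: has_vector_derivative_def has_derivative_at bounded_linear_scaleR_left
        tendsto_norm_zero_iff flip: LIM_zero_iff [of _ f'])
qed

lemma continuous_antiderivative_real_line:
  fixes f :: "real \<Rightarrow> 'a::banach"
  assumes f: "continuous_on UNIV f"
  obtains F where "\<And>t. (F has_vector_derivative f t) (at t)"
proof
  \<comment> \<open>For \<open>t \<noteq> 0\<close> one of the two intervals is empty, so this is
    the oriented integral from 0 to \<open>t\<close> for either sign of \<open>t\<close>.\<close>
  define F where "F t = integral {0..t} f - integral {t..0} f" for t
  fix t :: real
  \<comment> \<open>This puts 0 and \<open>t\<close> in the interior of \<open>{- b..b}\<close>.
    There \<open>F\<close> differs by a constant from the integral with fixed lower limit
    \<open>- b\<close>, which is differentiable by the fundamental theorem.\<close>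
  define b where "b = \<bar>t\<bar> + 1"
  have int: "f integrable_on {c..d}" for c d
    using f by (intro integrable_continuous_real) (rule continuous_on_subset, auto)
  have F_eq: "F s = integral {- b..s} f - integral {- b..0} f" if "s \<in> {- b<..<b}" for s
  proof (cases "0 \<le> s")
    case True
    then have "integral {- b..0} f + integral {0..s} f = integral {- b..s} f"
      using int by (intro Henstock_Kurzweil_Integration.integral_combine) (auto simp: b_def)
    then show ?thesis using True by (cases "s = 0") (auto simp: F_def algebra_simps)
  next
    case False
    then have "integral {- b..s} f + integral {s..0} f = integral {- b..0} f"
      using int that by (intro Henstock_Kurzweil_Integration.integral_combine) auto
    then show ?thesis using False by (auto simp: F_def algebra_simps)
  qed
  have t: "t \<in> {- b<..<b}" by (auto simp: b_def)
  have "((\<lambda>s. integral {- b..s} f) has_vector_derivative f t) (at t within {- b..b})"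
    using f t by (intro integral_has_vector_derivative) (auto intro: continuous_on_subset)
  then have "((\<lambda>s. integral {- b..s} f) has_vector_derivative f t) (at t)"
    using t at_within_Icc_at [of "- b" t b] by auto
  then have "((\<lambda>s. integral {- b..s} f - integral {- b..0} f) has_vector_derivative f t - 0) (at t)"
    by (intro has_vector_derivative_diff has_vector_derivative_const)
  then show "(F has_vector_derivative f t) (at t)"
    using has_vector_derivative_transform_within_open [OF _ open_greaterThanLessThan t, of _ "f t" F] F_eq
    by fastforce
qed

section \<open>Orbits of a C0-group and its generator\<close>

context
  fixes D :: "'a::complex_banach set" and G T
  assumes gen: "generates_C0_group D G T"
begin

lemma C0_group_bounded_linear: "bounded_linear (T t)"
  and C0_group_0: "T 0 z = z"
  and C0_group_add: "T (s + t) z = T s (T t z)"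
  and C0_group_continuous: "continuous_on UNIV (\<lambda>t. T t z)"
  using gen by (auto simp: generates_C0_group_def C0_group_def bounded_clinear_def)

text \<open>Uniqueness of limits lets one derivative at 0 deliver both membership in the domain and
  the value of the generator.\<close>

lemma generator_iff:
  "z \<in> D \<and> G z = w \<longleftrightarrow> ((\<lambda>h. T h z) has_vector_derivative w) (at 0)"
  using gen C0_group_0 tendsto_unique [OF trivial_limit_at]
  unfolding generates_C0_group_def has_vector_derivative_iff_quotient by fastforce

text \<open>Read \<open>T (t + h) z\<close> in two ways: as \<open>T t (T h z)\<close>, where the
  bounded \<open>T t\<close> passes through the limit, and as \<open>T h (T t z)\<close>, whose
  derivative at \<open>h = 0\<close> is the generator at \<open>T t z\<close>.\<close>

lemma generator_orbit:
  assumes "z \<in> D"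
  shows generator_orbit_derivative: "((\<lambda>t. T t z) has_vector_derivative T t (G z)) (at t)"
    and generator_orbit_mem: "T t z \<in> D"
    and generator_orbit_commute: "G (T t z) = T t (G z)"
proof -
  interpret T: bounded_linear "T t" by (rule C0_group_bounded_linear)
  have "((\<lambda>h. (1 / h) *\<^sub>R (T h z - z)) \<longlongrightarrow> G z) (at 0)"
    using gen assms by (auto simp: generates_C0_group_def)
  from T.tendsto [OF this]
  have lim: "((\<lambda>h. (1 / h) *\<^sub>R (T (t + h) z - T t z)) \<longlongrightarrow> T t (G z)) (at 0)"
    by (simp add: T.scaleR T.diff C0_group_add)
  then show "((\<lambda>t. T t z) has_vector_derivative T t (G z)) (at t)"
    by (simp add: has_vector_derivative_iff_quotient)
  have "T (t + h) z = T h (T t z)" for h by (metis C0_group_add add.commute)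
  with lim have "((\<lambda>h. T h (T t z)) has_vector_derivative T t (G z)) (at 0)"
    by (simp add: has_vector_derivative_iff_quotient C0_group_0)
  then show "T t z \<in> D" "G (T t z) = T t (G z)" by (simp_all flip: generator_iff)
qed

text \<open>The integral \<open>F t - F 0\<close> of an arbitrary orbit lies in the domain, because
  \<open>T h\<close> only shifts the limits of integration and the result is differentiable in
  \<open>h\<close>.\<close>

lemma generator_integral:
  obtains F where "\<And>t. (F has_vector_derivative T t z) (at t)"
    and "\<And>t. F t - F 0 \<in> D" and "\<And>t. G (F t - F 0) = T t z - z"
proof -
  obtain F where F: "\<And>t. (F has_vector_derivative T t z) (at t)"
    using continuous_antiderivative_real_line [OF C0_group_continuous] by blast
  have F_shift: "((\<lambda>s. F (c + s)) has_vector_derivative T (c + s) z) (at s)" for c s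
    using F [of "c + s"] by (simp add: has_vector_derivative_iff_quotient add.assoc)
  have T_F: "T h (F t - F 0) = F (t + h) - F h" for h t
  proof -
    \<comment> \<open>Both terms are antiderivatives of the shifted orbit, so their difference is
      constant; comparing \<open>s = t\<close> with \<open>s = 0\<close> gives the claim.\<close>
    have "((\<lambda>s. T h (F s) - F (h + s)) has_vector_derivative 0) (at s)" for s
    proof -
      have "((\<lambda>s. T h (F s)) has_vector_derivative T (h + s) z) (at s)"
        using bounded_linear.has_vector_derivative [OF C0_group_bounded_linear F]
        by (simp add: C0_group_add)
      from has_vector_derivative_diff [OF this F_shift [of h]] show ?thesis by simp
    qed
    then obtain c where "\<And>s. T h (F s) - F (h + s) = c"
      using has_vector_derivative_zero_constant [of UNIV "\<lambda>s. T h (F s) - F (h + s)"] by auto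
    from this [of t] this [of 0] show ?thesis
      by (simp add: linear_diff [OF bounded_linear.linear [OF C0_group_bounded_linear]]
          algebra_simps)
  qed
  have "((\<lambda>h. T h (F t - F 0)) has_vector_derivative T t z - z) (at 0)" for t
    using has_vector_derivative_diff [OF F_shift F, of t 0] by (simp add: T_F C0_group_0)
  then have "F t - F 0 \<in> D \<and> G (F t - F 0) = T t z - z" for t by (simp add: generator_iff)
  then show thesis using that F by blast
qed

end

lemma Ck_SucI:
  "(\<And>t. (f has_vector_derivative f' t) (at t)) \<Longrightarrow> Ck k f' \<Longrightarrow> Ck (Suc k) f"
  by auto

section \<open>The block group, with \<open>B\<close> as a bounded operator on
  \<open>Y\<close>\<close>

locale block_group =
  fixes A B :: "'x::complex_banach \<Rightarrow> 'x"
    and domA domB :: "'x set"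
    and \<iota> :: "'y::complex_banach \<Rightarrow> 'x"
    and T :: "real \<Rightarrow> 'y \<times> 'x \<Rightarrow> 'y \<times> 'x"
  assumes closed_A: "closed_linear_operator domA A"
    and closed_B: "closed_linear_operator domB B"
    and embedding: "continuous_embedding \<iota>"
    and domA: "domA \<subseteq> dom_square domB B \<inter> range \<iota>"
    and B_domA: "B ` domA \<subseteq> range \<iota>"
    and range_domB: "range \<iota> \<subseteq> domB"
    and gen: "generates_C0_group (G_dom \<iota> domA) (G_op \<iota> A B) T"
begin

abbreviation "u t x \<equiv> T12 T t x"
abbreviation "v t x \<equiv> T22 T t x"
abbreviation "S \<equiv> gen_sine \<iota> T"
abbreviation "C \<equiv> gen_cosine \<iota> B T"
abbreviation "K w \<equiv> B (\<iota> w)"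

lemma bounded_linear_\<iota>: "bounded_linear \<iota>"
  using embedding by (auto simp: continuous_embedding_def bounded_clinear_def)

sublocale \<iota>: bounded_linear \<iota> by (rule bounded_linear_\<iota>)

lemma inv_\<iota> [simp]: "inv \<iota> (\<iota> w) = w"
  using embedding by (simp add: continuous_embedding_def)

lemma closed_operator_scaleR:
  assumes "closed_linear_operator E L" "x \<in> E"
  shows "r *\<^sub>R x \<in> E" "L (r *\<^sub>R x) = r *\<^sub>R L x"
  using assms by (auto simp: closed_linear_operator_def scaleR_scaleC)

lemma closed_operator_diff:
  assumes "closed_linear_operator E L" "x \<in> E" "y \<in> E"
  shows "x - y \<in> E" "L (x - y) = L x - L y"
proof -
  have y: "- y \<in> E" "L (- y) = - L y"
    using closed_operator_scaleR [OF assms(1,3), of "-1"] by simp_all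
  have "x + - y \<in> E \<and> L (x + - y) = L x + L (- y)"
    using assms y by (auto simp only: closed_linear_operator_def)
  then show "x - y \<in> E" "L (x - y) = L x - L y" using y by simp_all
qed

lemma closed_operator_add:
  assumes "closed_linear_operator E L" "x \<in> E" "y \<in> E"
  shows "x + y \<in> E" "L (x + y) = L x + L y"
  using assms by (auto simp: closed_linear_operator_def)

lemmas B_scaleR = closed_operator_scaleR [OF closed_B]
  and B_diff = closed_operator_diff [OF closed_B]
  and B_add = closed_operator_add [OF closed_B]

lemma \<iota>_domB [simp]: "\<iota> w \<in> domB"
  using range_domB by auto

text \<open>Convergence in \<open>Y\<close> implies convergence in \<open>X\<close>, so the closed
  graph of \<open>B\<close> makes the restriction of \<open>B\<close> to \<open>Y\<close> closed for
  the norm of \<open>Y\<close>.\<close>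

lemma bounded_linear_K: "bounded_linear K"
proof (rule closed_graph_bounded_linear)
  show "linear K"
    by (rule linearI) (simp_all add: \<iota>.add \<iota>.scaleR B_add B_scaleR)
next
  fix X a b
  assume "X \<longlonglongrightarrow> a" and b: "(\<lambda>n. K (X n)) \<longlonglongrightarrow> b"
  then have "(\<lambda>n. (\<iota> (X n), K (X n))) \<longlonglongrightarrow> (\<iota> a, b)"
    by (intro tendsto_Pair \<iota>.tendsto)
  moreover have "closed {(x, B x) |x. x \<in> domB}"
    using closed_B by (simp add: closed_linear_operator_def)
  moreover have "\<forall>n. (\<iota> (X n), K (X n)) \<in> {(x, B x) |x. x \<in> domB}"
    by simp
  ultimately have "(\<iota> a, b) \<in> {(x, B x) |x. x \<in> domB}"
    by (metis (no_types, lifting) closed_sequentially)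
  then show "K a = b" by simp
qed

sublocale K: bounded_linear K by (rule bounded_linear_K)

sublocale T: bounded_linear "T t" for t
  by (rule C0_group_bounded_linear [OF gen])

text \<open>Removes \<open>inv \<iota>\<close> from the first row: on the domain, \<open>B\<close>
  maps into \<open>Y\<close>, so that row really is an element of \<open>Y\<close>. The memberships
  in \<open>domB\<close> allow \<open>B\<close> to be applied termwise.\<close>

lemma G_domD:
  assumes "p \<in> G_dom \<iota> domA"
  shows "\<iota> (fst (G_op \<iota> A B p)) = snd p - K (fst p)"
    and "K (fst p) \<in> domB"
    and "snd p \<in> domB"
    and "\<iota> (fst p) \<in> domA"
    and "snd (G_op \<iota> A B p) = A (\<iota> (fst p)) + B (K (fst p)) - B (snd p)"
proof -
  obtain a b where p: "p = (a, \<iota> b)" and a: "\<iota> a \<in> domA"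
    using assms by (auto simp: G_dom_def)
  obtain c where c: "K a = \<iota> c" using B_domA a by blast
  have "- K a + \<iota> b = \<iota> (b - c)" by (simp add: c \<iota>.diff)
  then have "fst (G_op \<iota> A B p) = b - c"
    by (simp only: p G_op_def prod.case fst_conv inv_\<iota>)
  then show "\<iota> (fst (G_op \<iota> A B p)) = snd p - K (fst p)"
    by (simp add: p c \<iota>.diff)
  show "K (fst p) \<in> domB" by (simp add: p c)
  show "snd p \<in> domB" "\<iota> (fst p) \<in> domA" using p a by simp_all
  show "snd (G_op \<iota> A B p) = A (\<iota> (fst p)) + B (K (fst p)) - B (snd p)"
    by (simp add: p G_op_def)
qed

text \<open>The first row involves only bounded operators, so its integrated form can be
  differentiated in \<open>X\<close> even when \<open>z\<close> is outside the domain of the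
  generator.\<close>

lemma orbit_fst_derivative:
  "((\<lambda>t. \<iota> (fst (T t z))) has_vector_derivative snd (T t z) - K (fst (T t z))) (at t)"
proof -
  obtain F where F: "\<And>t. (F has_vector_derivative T t z) (at t)"
    and D: "\<And>t. F t - F 0 \<in> G_dom \<iota> domA"
    and GF: "\<And>t. G_op \<iota> A B (F t - F 0) = T t z - z"
    using generator_integral [OF gen] by blast
  define P where "P s = F s - F 0" for s
  have P: "(P has_vector_derivative T t z) (at t)"
    unfolding P_def using has_vector_derivative_diff [OF F has_vector_derivative_const] by simp
  have "\<iota> (fst (T s z)) = snd (P s) - K (fst (P s)) + \<iota> (fst z)" for s
    using G_domD(1) [OF D [of s], unfolded GF] by (simp add: P_def \<iota>.diff algebra_simps)
  then have eq: "(\<lambda>s. \<iota> (fst (T s z))) = (\<lambda>s. snd (P s) - K (fst (P s)) + \<iota> (fst z))"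
    by (rule ext)
  have "((\<lambda>s. snd (P s) - K (fst (P s)) + \<iota> (fst z)) has_vector_derivative
      snd (T t z) - K (fst (T t z)) + 0) (at t)"
    by (intro has_vector_derivative_add has_vector_derivative_diff has_vector_derivative_const
        K.has_vector_derivative bounded_linear.has_vector_derivative [OF bounded_linear_fst]
        bounded_linear.has_vector_derivative [OF bounded_linear_snd] P)
  then show ?thesis by (simp only: eq add_0_right)
qed

lemma continuous_u: "continuous_on UNIV (\<lambda>t. u t x)"
  and continuous_v: "continuous_on UNIV (\<lambda>t. v t x)"
  unfolding T12_def T22_def by (intro continuous_intros C0_group_continuous [OF gen])+

lemma sine_derivative: "((\<lambda>t. S t x) has_vector_derivative v t x - B (S t x)) (at t)"
  using orbit_fst_derivative [of "(0, x)"] by (simp add: gen_sine_def T12_def T22_def)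

text \<open>The last summand of \<open>gen_cosine\<close> cancels, which reduces (ii) to
  (i).\<close>

lemma cosine_sine_eq: "C t x - 2 *\<^sub>R S t (B x) = v t x - B (S t x)"
  by (simp add: gen_cosine_def gen_sine_def)

lemma sine_regularity: "Ck 1 (\<lambda>t. S t x)" "Ck_embedded \<iota> 0 (\<lambda>t. S t x)"
proof -
  have "continuous_on UNIV (\<lambda>t. v t x - B (S t x))"
    unfolding gen_sine_def by (intro continuous_on_diff continuous_v K.continuous_on continuous_u)
  then show "Ck 1 (\<lambda>t. S t x)"
    unfolding One_nat_def by (intro Ck_SucI [OF sine_derivative]) simp
  show "Ck_embedded \<iota> 0 (\<lambda>t. S t x)"
    unfolding Ck_embedded_def gen_sine_def using continuous_u by auto
qed

lemma zero_domA: "0 \<in> domA"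
  using closed_A by (simp add: closed_linear_operator_def)

lemma zero_range_G_dom: "(0, \<iota> w) \<in> G_dom \<iota> domA"
  using zero_domA by (simp add: G_dom_def \<iota>.zero)

lemma G_op_zero_range: "G_op \<iota> A B (0, \<iota> w) = (w, - K w)"
proof -
  have "A 0 = 0" using closed_operator_scaleR(2) [OF closed_A zero_domA, of 0] by simp
  then show ?thesis using K.zero by (simp add: G_op_def \<iota>.zero)
qed

section \<open>Initial values in \<open>Y\<close> and in \<open>domA\<close>\<close>

context
  fixes w :: 'y
begin

abbreviation "p t \<equiv> T t (w, - K w)"

lemma G_orbit: "G_op \<iota> A B (T t (0, \<iota> w)) = p t"
  using generator_orbit_commute [OF gen zero_range_G_dom] by (simp add: G_op_zero_range)

text \<open>The rows of the generator equation along the orbit of \<open>(0, \<iota> w)\<close>: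
  \<open>\<iota> (fst (p t))\<close> is \<open>v - K u\<close>, and \<open>snd (p t)\<close> is
  \<open>A (\<iota> u) + B (K u) - B v\<close>, with \<open>u\<close>, \<open>v\<close> taken at
  \<open>t\<close> and \<open>\<iota> w\<close>.\<close>

lemmas orbit_G_domD = G_domD [OF generator_orbit_mem [OF gen zero_range_G_dom [of w]],
    unfolded G_orbit, folded T12_def T22_def]

lemma orbit_range_derivative:
  shows u_range_derivative: "((\<lambda>t. u t (\<iota> w)) has_vector_derivative fst (p t)) (at t)"
    and v_range_derivative: "((\<lambda>t. v t (\<iota> w)) has_vector_derivative snd (p t)) (at t)"
proof -
  have "((\<lambda>t. T t (0, \<iota> w)) has_vector_derivative p t) (at t)"
    using generator_orbit_derivative [OF gen zero_range_G_dom] by (simp add: G_op_zero_range)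
  then show "((\<lambda>t. u t (\<iota> w)) has_vector_derivative fst (p t)) (at t)"
    and "((\<lambda>t. v t (\<iota> w)) has_vector_derivative snd (p t)) (at t)"
    unfolding T12_def T22_def
    by (rule bounded_linear.has_vector_derivative [OF bounded_linear_fst]
        bounded_linear.has_vector_derivative [OF bounded_linear_snd])+
qed

lemma continuous_p: "continuous_on UNIV p"
  by (rule C0_group_continuous [OF gen])

lemma continuous_fst_p: "continuous_on UNIV (\<lambda>t. fst (p t))"
  and continuous_snd_p: "continuous_on UNIV (\<lambda>t. snd (p t))"
  by (intro continuous_intros continuous_p)+

lemma sine_range_derivative: "((\<lambda>t. S t (\<iota> w)) has_vector_derivative \<iota> (fst (p t))) (at t)"
  unfolding gen_sine_def by (rule \<iota>.has_vector_derivative [OF u_range_derivative])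

text \<open>The starting value \<open>(w, - K w)\<close> of \<open>p\<close> need not lie in the
  domain, which is why the derivative is taken from the integrated equation.\<close>

lemma sine_range_second_derivative:
  "((\<lambda>t. \<iota> (fst (p t))) has_vector_derivative snd (p t) - K (fst (p t))) (at t)"
  by (rule orbit_fst_derivative)

lemma second_derivative_sine_range: "second_derivative (\<lambda>t. S t (\<iota> w)) t = snd (p t) - K (fst (p t))"
  using vector_derivative_at [OF sine_range_second_derivative]
  by (simp add: second_derivative_def vector_derivative_at [OF sine_range_derivative])

text \<open>Solve the second row for \<open>A\<close> and insert the first row into
  \<open>B (v - K u)\<close>. The unbounded \<open>A\<close> is thereby expressed through continuous
  functions of \<open>t\<close>.\<close>

lemma A_sine_range: "A (S t (\<iota> w)) = snd (p t) + K (fst (p t))"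
  using orbit_G_domD [of t] by (simp add: gen_sine_def B_diff)

lemma sine_range_regularity:
  "Ck 2 (\<lambda>t. S t (\<iota> w))" "Ck_embedded \<iota> 1 (\<lambda>t. S t (\<iota> w))"
proof -
  have "continuous_on UNIV (\<lambda>t. snd (p t) - K (fst (p t)))"
    by (intro continuous_on_diff continuous_snd_p K.continuous_on continuous_fst_p)
  then show "Ck 2 (\<lambda>t. S t (\<iota> w))"
    unfolding numeral_2_eq_2
    by (intro Ck_SucI [OF sine_range_derivative] Ck_SucI [OF sine_range_second_derivative]) simp
  have "Ck 1 (\<lambda>t. u t (\<iota> w))"
    unfolding One_nat_def by (intro Ck_SucI [OF u_range_derivative]) (simp add: continuous_fst_p)
  then show "Ck_embedded \<iota> 1 (\<lambda>t. S t (\<iota> w))"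
    unfolding Ck_embedded_def gen_sine_def by (intro exI [of _ "\<lambda>t. u t (\<iota> w)"] conjI allI refl)
qed

lemma sine_range_continuous_into_dom: "continuous_into_dom domA A (\<lambda>t. S t (\<iota> w))"
  unfolding continuous_into_dom_def
proof (intro conjI allI)
  show S_domA: "S t (\<iota> w) \<in> domA" for t
    using orbit_G_domD(4) by (simp add: gen_sine_def)
  fix t
  have AS: "continuous_on UNIV (\<lambda>t. A (S t (\<iota> w)))" unfolding A_sine_range
    by (intro continuous_on_add continuous_snd_p K.continuous_on continuous_fst_p)
  have S: "continuous_on UNIV (\<lambda>t. S t (\<iota> w))"
    unfolding gen_sine_def by (intro \<iota>.continuous_on continuous_u)
  have "((\<lambda>s. norm (S s (\<iota> w) - S t (\<iota> w)) + norm (A (S s (\<iota> w)) - A (S t (\<iota> w)))) \<longlongrightarrow> 0 + 0) (at t)"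
    using S AS by (intro tendsto_add tendsto_norm_zero LIM_zero) (auto simp: continuous_on_def)
  then show "((\<lambda>s. graph_norm A (S s (\<iota> w) - S t (\<iota> w))) \<longlongrightarrow> 0) (at t)"
    by (simp add: graph_norm_def closed_operator_diff [OF closed_A S_domA S_domA])
qed

text \<open>By the first row, \<open>v - K u\<close> is \<open>\<iota> (fst (p t))\<close>; thus the
  cosine maps \<open>Y\<close> into \<open>Y\<close>, where \<open>B\<close> acts as
  \<open>K\<close>.\<close>

lemma cosine_range:
  shows cosine_range_domB: "C t (\<iota> w) \<in> domB"
    and B_cosine_range: "B (C t (\<iota> w)) = K (fst (p t)) + 2 *\<^sub>R B (S t (K w))"
proof -
  have "C t (\<iota> w) = \<iota> (fst (p t) + 2 *\<^sub>R u t (K w))"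
    by (simp add: gen_cosine_def orbit_G_domD \<iota>.add \<iota>.scaleR)
  then show "C t (\<iota> w) \<in> domB"
    and "B (C t (\<iota> w)) = K (fst (p t)) + 2 *\<^sub>R B (S t (K w))"
    by (simp_all add: K.add K.scaleR gen_sine_def)
qed

text \<open>Both sides equal \<open>snd (p t) - K (fst (p t))\<close>: the terms
  \<open>B (S t (K w))\<close> cancel, and \<open>- 2 K (fst (p t))\<close> flips the sign in the
  formula for \<open>A\<close>.\<close>

lemma sine_range_equation:
  "second_derivative (\<lambda>t. S t (\<iota> w)) t
     = A (S t (\<iota> w)) - 2 *\<^sub>R B (C t (\<iota> w)) + 4 *\<^sub>R B (S t (K w))"
  by (simp add: second_derivative_sine_range A_sine_range B_cosine_range scaleR_add_right
      scaleR_2 [of "K (fst (p t))"])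

lemma sine_domA_equation:
  assumes "\<iota> w \<in> domA"
  shows "second_derivative (\<lambda>t. S t (\<iota> w)) t + 2 *\<^sub>R vector_derivative (\<lambda>t. S t (K w)) (at t)
     = S t (A (\<iota> w))"
proof -
  have "K w \<in> range \<iota>" using B_domA imageI [OF assms, of B] by (rule subsetD)
  then obtain b where b: "K w = \<iota> b" by (rule imageE)
  then have minus_b: "- K w = \<iota> (- b)" by (simp add: \<iota>.neg)
  have mem: "(w, - K w) \<in> G_dom \<iota> domA"
    unfolding minus_b using assms by (simp add: G_dom_def)
  have G: "G_op \<iota> A B (w, - K w) = (- (2 *\<^sub>R b), A (\<iota> w) + 2 *\<^sub>R K b)"
  proof -
    have "- K w + - K w = \<iota> (- b + - b)" unfolding minus_b by (rule \<iota>.add [symmetric])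
    also have "- b + - b = - (2 *\<^sub>R b)" by (simp add: scaleR_2)
    finally have "inv \<iota> (- K w + - K w) = - (2 *\<^sub>R b)" by (simp only: inv_\<iota>)
    moreover have "B (- K w) = - K b" unfolding minus_b by (rule K.neg)
    moreover have "K b = B (K w)" by (simp only: b)
    ultimately show ?thesis by (simp add: G_op_def scaleR_2)
  qed
  \<comment> \<open>Since \<open>(w, - K w)\<close> now lies in the domain, \<open>p\<close> itself
    is differentiable, and the derivative of its first component has a second expression through the
    group.\<close>
  have "((\<lambda>t. \<iota> (fst (p t))) has_vector_derivative
      \<iota> (fst (T t (- (2 *\<^sub>R b), A (\<iota> w) + 2 *\<^sub>R K b)))) (at t)"
    using generator_orbit_derivative [OF gen mem]
    by (intro \<iota>.has_vector_derivative bounded_linear.has_vector_derivative [OF bounded_linear_fst])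
      (simp add: G)
  then have "second_derivative (\<lambda>t. S t (\<iota> w)) t
      = \<iota> (fst (T t (- (2 *\<^sub>R b), A (\<iota> w) + 2 *\<^sub>R K b)))"
    by (simp add: second_derivative_def vector_derivative_at
        vector_derivative_at [OF sine_range_derivative])
  moreover have "vector_derivative (\<lambda>t. S t (K w)) (at t) = \<iota> (fst (T t (b, - K b)))"
    using generator_orbit_derivative [OF gen zero_range_G_dom, of b]
    unfolding gen_sine_def T12_def b
    by (intro vector_derivative_at \<iota>.has_vector_derivative
        bounded_linear.has_vector_derivative [OF bounded_linear_fst])
      (simp add: G_op_zero_range)
  \<comment> \<open>Here \<open>(b, - K b)\<close> is the generator at \<open>(0, K w)\<close>. The
    sum is an initial value whose orbit has first component
    \<open>T12 T t (A (\<iota> w))\<close>.\<close>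
  moreover have "(- (2 *\<^sub>R b), A (\<iota> w) + 2 *\<^sub>R K b) + 2 *\<^sub>R (b, - K b) = (0, A (\<iota> w))"
    by simp
  ultimately show ?thesis
    unfolding gen_sine_def T12_def by (metis T.add T.scaleR \<iota>.add \<iota>.scaleR fst_add fst_scaleR)
qed

end

end

section \<open>Assembly of the four assertions\<close>

theorem lemma4p2:
  fixes A B :: "'x::complex_banach \<Rightarrow> 'x"
    and domA domB :: "'x set"
    and \<iota> :: "'y::complex_banach \<Rightarrow> 'x"
    and T :: "real \<Rightarrow> 'y \<times> 'x \<Rightarrow> 'y \<times> 'x"
  defines "S \<equiv> gen_sine \<iota> T"
    and "C \<equiv> gen_cosine \<iota> B T"
  assumes "closed_linear_operator domA A"
    and "closed_linear_operator domB B"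
    and "resolvent_set domB B \<noteq> {}"
    and "continuous_embedding \<iota>"
    and "domA \<subseteq> dom_square domB B \<inter> range \<iota>"
    and "B ` domA \<subseteq> range \<iota>"
    and "range \<iota> \<subseteq> domB"
    and "generates_C0_group (G_dom \<iota> domA) (G_op \<iota> A B) T"
  shows
    "(\<forall>x. Ck 1 (\<lambda>t. S t x) \<and> Ck_embedded \<iota> 0 (\<lambda>t. S t x) \<and>
        (\<forall>t. ((\<lambda>t. S t x) has_vector_derivative (T22 T t x - B (S t x))) (at t))) \<and>
     (\<forall>x\<in>domB. \<forall>t.
        ((\<lambda>t. S t x) has_vector_derivative (C t x - 2 *\<^sub>R S t (B x))) (at t)) \<and>
     (\<forall>y\<in>range \<iota>.
        Ck 2 (\<lambda>t. S t y) \<and> Ck_embedded \<iota> 1 (\<lambda>t. S t y) \<and>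
        continuous_into_dom domA A (\<lambda>t. S t y) \<and>
        (\<forall>t. ((\<lambda>t. S t y) has_vector_derivative (C t y - 2 *\<^sub>R S t (B y))) (at t) \<and>
             C t y \<in> domB \<and>
             second_derivative (\<lambda>t. S t y) t
               = A (S t y) - 2 *\<^sub>R B (C t y) + 4 *\<^sub>R B (S t (B y)))) \<and>
     (\<forall>x\<in>domA. \<forall>t.
        second_derivative (\<lambda>t. S t x) t + 2 *\<^sub>R vector_derivative (\<lambda>t. S t (B x)) (at t)
          = S t (A x))"
proof -
  interpret block_group A B domA domB \<iota> T
    using assms by (intro block_group.intro)
  show ?thesis
    unfolding S_def C_def
  proof (intro conjI ballI allI)
    fix t x
    show "Ck 1 (\<lambda>t. gen_sine \<iota> T t x)" "Ck_embedded \<iota> 0 (\<lambda>t. gen_sine \<iota> T t x)"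
      by (rule sine_regularity)+
    show "((\<lambda>t. gen_sine \<iota> T t x) has_vector_derivative T22 T t x - B (gen_sine \<iota> T t x)) (at t)"
      by (rule sine_derivative)
    show "((\<lambda>t. gen_sine \<iota> T t x) has_vector_derivative
        gen_cosine \<iota> B T t x - 2 *\<^sub>R gen_sine \<iota> T t (B x)) (at t)"
      unfolding cosine_sine_eq by (rule sine_derivative)
    show "((\<lambda>t. gen_sine \<iota> T t x) has_vector_derivative
        gen_cosine \<iota> B T t x - 2 *\<^sub>R gen_sine \<iota> T t (B x)) (at t)"
      unfolding cosine_sine_eq by (rule sine_derivative)
  \<comment> \<open>The remaining goals concern points of \<open>range \<iota>\<close> or of
    \<open>domA\<close>, which is contained in it; such points have the form
    \<open>\<iota> w\<close>.\<close>
  qed (use domA sine_range_regularity sine_range_continuous_into_dom cosine_range_domB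
      sine_range_equation sine_domA_equation in blast)+
qed

end
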